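(* Let $(A,B,C,D)$ be a regular linear system on a separable Hilbert space $X$ with finite-dimensional real input space $U=\mathbb{R}^m$ and finite-dimensional real output space $Y=\mathbb{R}^p$. Let $(A_d,B_d,C_d,D_d)$ be its Cayley-Tustin discretization with parameter $\delta=2/h\in\rho(A)$, $h>0$. Let $Q\in\mathcal{L}(Y)$ and $R\in\mathcal{L}(U)$ be positive self-adjoint weights, let $N\ge 1$ be the horizon length, and let $u_{\min},u_{\max}\in U$ and $y_{\min},y_{\max}\in Y$ be the constraint bounds. Assume that $A$ is the generator of a strongly stable $C_0$-semigroup on $X$ and that $C$ is an infinite-time admissible observation operator for $A$. Let $\bar Q\in\mathcal{L}(X)$ be the unique positive self-adjoint solution of the discrete-time Lyapunov equation $A_d^*\bar QA_d-\bar Q=-C_d^*QC_d$. For $x\in X$ consider the quadratic optimization problem $$\min_{V\in U^N} J(V,x)=V^THV+2V^T(Px)$$ subject to $$\begin{bmatrix} I\\ -I\\ S\\ -S\end{bmatrix}V\le\begin{bmatrix}U_{\max}\\ -U_{\min}\\ Y_{\max}-Tx\\ -Y_{\min}+Tx\end{bmatrix},$$ where $H,P,S,T$ are the operators given in the context. Let $x_0\in X$, and let the model predictive control scheme be run from $x_0$: at each sampling time $k=0,1,2,\dots$ the quadratic optimization problem of minimizing $J(V,x_k)=V^THV+2V^T(Px_k)$ over $V\in U^N$ subject to $U_{\min}\le V\le U_{\max}$ and $Y_{\min}\le SV+Tx_k\le Y_{\max}$, assumed feasible, is solved to give $U_k$; the first component $u_{k+1}\in U$ of $U_k$ is applied,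 and $x_{k+1}=A_dx_k+B_du_{k+1}$. Then the sequence $(U_k)$ of solutions, and hence the sequence of inputs $(u_k)$, converges to zero.
   Context: Regular linear systems: $X$ is a separable Hilbert space and $A:\mathcal{D}(A)\subset X\to X$ generates a $C_0$-semigroup $T(t)$ on $X$. For a fixed $s_0\in\rho(A)$, $X_1$ is $\mathcal{D}(A)$ with norm $\|(s_0-A)\cdot\|$, $X_{-1}$ is the completion of $X$ in the norm $\|(s_0-A)^{-1}\cdot\|$, and $A_{-1}$ is the extension of $A$ to $X_{-1}$. The operators are $B\in\mathcal{L}(U,X_{-1})$, $C\in\mathcal{L}(X_1,Y)$, $D\in\mathcal{L}(U,Y)$, and $(A,B,C,D)$ is a well-posed linear system; $B$ and $C$ are admissible for $A$. Admissibility of $B$: for some $\tau>0$, $\int_0^\tau T(\tau-s)Bu(s)\,ds\in X$ for all $u\in L^2(0,\infty;U)$. Admissibility of $C$: for some $\tau>0$ there is $K_\tau$ with $\int_0^\tau\|CT(s)x\|^2ds\le K_\tau\|x\|^2$ for all $x\in\mathcal{D}(A)$. $C$ is infinite-time admissible if there is a constant $K$ such that $\int_0^\tau\|CT(s)x\|^2ds\le K\|x\|^2$ for all $\tau>0$ and $x\in\mathcal{D}(A)$. The system is regular if its transfer function $G$ satisfies $\lim_{\lambda\to\infty}G(\lambda)u=Du$ for all $u\in U$; then $G(s)=C_\Lambda(s-A_{-1})^{-1}B+D$, where $C_\Lambda x=\lim_{\lambda\to\infty}\lambda C(\lambda-A)^{-1}x$ on the set of $x\in X$ for which the limit exists. Strong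 stability of the semigroup means $T(t)x\to0$ as $t\to\infty$ for every $x\in X$. Cayley-Tustin discretization: for $\delta=2/h\in\rho(A)$, $$A_d=-I+2\delta(\delta-A)^{-1},\quad B_d=\sqrt{2\delta}(\delta-A_{-1})^{-1}B,\quad C_d=\sqrt{2\delta}\,C(\delta-A)^{-1},\quad D_d=G(\delta),$$ all bounded operators; the discrete-time system is $x_j=A_dx_{j-1}+B_du_j$, $y_j=C_dx_{j-1}+D_du_j$. The weights $Q,R$ are positive definite; for $\bar Q$, positive means $\langle x,\bar Qx\rangle\ge0$ for all $x$. Operators in the optimization problem: $H\in\mathcal{L}(U^N)$ is the self-adjoint block operator with blocks $h_{i,i}=D_d^*QD_d+B_d^*\bar QB_d+R$; $h_{i,j}=D_d^*QC_dA_d^{i-j-1}B_d+B_d^*\bar QA_d^{i-j}B_d$ for $i>j$; $h_{i,j}=h_{j,i}^*$ for $i<j$. $P\in\mathcal{L}(X,U^N)$ has components $D_d^*QC_dA_d^{n-1}+B_d^*\bar QA_d^n$, $n=1,\dots,N$. $S\in\mathcal{L}(U^N,Y^N)$ has blocks $s_{i,i}=D_d$, $s_{i,j}=C_dA_d^{i-j-1}B_d$ for $i>j$, and $s_{i,j}=0$ for $i<j$. $T\in\mathcal{L}(X,Y^N)$ (not to be confused with the semigroup) has components $C_dA_d^{n-1}$, $n=1,\dots,N$. $U_{\min},U_{\max}\in U^N$ and $Y_{\min},Y_{\max}\in Y^N$ are the $N$-fold repetitions of $u_{\min},u_{\max},y_{\min},y_{\max}$; inequalities are componentwise. Meaning of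 the problem: writing $V=(u_{k+1},\dots,u_{k+N})$ and $x=x_k$, the quantity $J(V,x_k)+\langle x_k,\bar Qx_k\rangle$ equals $\sum_{j=k+1}^{k+N}\left(\langle y_j,Qy_j\rangle_Y+\langle u_j,Ru_j\rangle_U\right)+\langle x_{k+N},\bar Qx_{k+N}\rangle_X$ along the discrete-time system. It is obtained from the infinite-horizon problem of minimizing $\sum_{j\ge k+1}\left(\langle y_j,Qy_j\rangle_Y+\langle u_j,Ru_j\rangle_U\right)$ subject to $u_{\min}\le u_j\le u_{\max}$, $y_{\min}\le y_j\le y_{\max}$, under the convention that the input is zero beyond the horizon ($u_{k+N+i}=0$ for $i\ge1$). The displayed constraints express $u_{\min}\le u_j\le u_{\max}$ and $y_{\min}\le y_j\le y_{\max}$ for $j=k+1,\dots,k+N$.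
   Formalization: Mere feasibility of the displayed problem does not give convergence (the input can stay constant and nonzero), so it is additionally assumed that each solution U_k, followed by zero inputs beyond the horizon, satisfies the input and output bounds at all later times. *)

theory Defs
  imports "HOL-Analysis.Analysis"
begin

section \<open>Semigroups, generators, resolvents\<close>

definition c0_semigroup :: "(real \<Rightarrow> 'x::real_normed_vector \<Rightarrow>\<^sub>L 'x) \<Rightarrow> bool" where
  "c0_semigroup T \<longleftrightarrow>
     T 0 = id_blinfun \<and>
     (\<forall>s\<ge>0. \<forall>t\<ge>0. T (s + t) = T s o\<^sub>L T t) \<and>
     (\<forall>x. ((\<lambda>t. T t x) \<longlongrightarrow> x) (at_right 0))"

text \<open>An unbounded operator is a domain \<open>DA\<close> together with a total function \<open>A\<close> whose values
  outside \<open>DA\<close> are irrelevant.\<close>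

definition generates ::
  "'x::real_normed_vector set \<Rightarrow> ('x \<Rightarrow> 'x) \<Rightarrow> (real \<Rightarrow> 'x \<Rightarrow>\<^sub>L 'x) \<Rightarrow> bool" where
  "generates DA A T \<longleftrightarrow>
     c0_semigroup T \<and>
     DA = {x. \<exists>y. ((\<lambda>t. (T t x - x) /\<^sub>R t) \<longlongrightarrow> y) (at_right 0)} \<and>
     (\<forall>x\<in>DA. ((\<lambda>t. (T t x - x) /\<^sub>R t) \<longlongrightarrow> A x) (at_right 0))"

definition strongly_stable :: "(real \<Rightarrow> 'x::real_normed_vector \<Rightarrow>\<^sub>L 'x) \<Rightarrow> bool" where
  "strongly_stable T \<longleftrightarrow> (\<forall>x. ((\<lambda>t. T t x) \<longlongrightarrow> 0) at_top)"

definition resolvent_set :: "'x::real_normed_vector set \<Rightarrow> ('x \<Rightarrow> 'x) \<Rightarrow> real set" where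
  "resolvent_set DA A =
     {s. bij_betw (\<lambda>x. s *\<^sub>R x - A x) DA UNIV \<and>
         bounded_linear (inv_into DA (\<lambda>x. s *\<^sub>R x - A x))}"

definition resolvent ::
  "'x::real_normed_vector set \<Rightarrow> ('x \<Rightarrow> 'x) \<Rightarrow> real \<Rightarrow> 'x \<Rightarrow>\<^sub>L 'x" where
  "resolvent DA A s = Blinfun (inv_into DA (\<lambda>x. s *\<^sub>R x - A x))"

section \<open>The spaces \<open>X\<^sub>1\<close> and \<open>X\<^sub>-\<^sub>1\<close>\<close>

definition bounded_on_X1 ::
  "real \<Rightarrow> 'x::real_normed_vector set \<Rightarrow> ('x \<Rightarrow> 'x) \<Rightarrow> ('x \<Rightarrow> 'y::real_normed_vector) \<Rightarrow> bool" where
  "bounded_on_X1 s0 DA A C \<longleftrightarrow>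
     (\<forall>x\<in>DA. \<forall>y\<in>DA. C (x + y) = C x + C y) \<and>
     (\<forall>r. \<forall>x\<in>DA. C (r *\<^sub>R x) = r *\<^sub>R C x) \<and>
     (\<exists>K. \<forall>x\<in>DA. norm (C x) \<le> K * norm (s0 *\<^sub>R x - A x))"

text \<open>The completion of \<open>X\<close> in the norm of \<open>(s\<^sub>0 - A)\<inverse>\<close> is unique up to isometric isomorphism. It is
  given here as a complete space \<open>'z\<close> with an embedding \<open>J\<close> of \<open>X\<close> onto a dense subspace of \<open>'z\<close>
  that carries the new norm to the norm of \<open>'z\<close>; elements of \<open>X\<close>, seen in \<open>X\<^sub>-\<^sub>1\<close>, are written \<open>J x\<close>.\<close>

definition extrapolation_space ::
  "real \<Rightarrow> 'x::real_normed_vector set \<Rightarrow> ('x \<Rightarrow> 'x) \<Rightarrow> ('x \<Rightarrow>\<^sub>L 'z::banach) \<Rightarrow> bool" where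
  "extrapolation_space s0 DA A J \<longleftrightarrow>
     s0 \<in> resolvent_set DA A \<and>
     (\<forall>x. norm (J x) = norm (resolvent DA A s0 x)) \<and>
     closure (range (blinfun_apply J)) = UNIV"

text \<open>\<open>A\<^sub>-\<^sub>1\<close>, as a bounded operator from its domain \<open>X\<close> to \<open>X\<^sub>-\<^sub>1\<close>; the inverse of
  \<open>s - A\<^sub>-\<^sub>1\<close>; and the extension of the semigroup to \<open>X\<^sub>-\<^sub>1\<close>.\<close>

definition ext_generator ::
  "'x::real_normed_vector set \<Rightarrow> ('x \<Rightarrow> 'x) \<Rightarrow> ('x \<Rightarrow>\<^sub>L 'z::banach) \<Rightarrow> 'x \<Rightarrow>\<^sub>L 'z" where
  "ext_generator DA A J = (THE L. \<forall>x\<in>DA. blinfun_apply L x = J (A x))"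

definition ext_resolvent ::
  "'x::real_normed_vector set \<Rightarrow> ('x \<Rightarrow> 'x) \<Rightarrow> ('x \<Rightarrow>\<^sub>L 'z::banach) \<Rightarrow> real \<Rightarrow> 'z \<Rightarrow>\<^sub>L 'x" where
  "ext_resolvent DA A J s = Blinfun (inv (\<lambda>x. s *\<^sub>R J x - ext_generator DA A J x))"

definition ext_semigroup ::
  "(real \<Rightarrow> 'x::real_normed_vector \<Rightarrow>\<^sub>L 'x) \<Rightarrow> ('x \<Rightarrow>\<^sub>L 'z::banach) \<Rightarrow> real \<Rightarrow> 'z \<Rightarrow>\<^sub>L 'z" where
  "ext_semigroup T J t = (THE S. \<forall>x. blinfun_apply S (J x) = J (T t x))"

section \<open>Regular linear systems\<close>

definition admissible_control ::
  "(real \<Rightarrow> 'x::real_normed_vector \<Rightarrow>\<^sub>L 'x) \<Rightarrow> ('x \<Rightarrow>\<^sub>L 'z::{banach,second_countable_topology}) \<Rightarrow>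
   ('u::euclidean_space \<Rightarrow>\<^sub>L 'z) \<Rightarrow> bool" where
  "admissible_control T J B \<longleftrightarrow>
     (\<exists>\<tau>>0. \<forall>u :: real \<Rightarrow> 'u.
        set_borel_measurable lborel {0<..} u \<and> set_integrable lborel {0<..} (\<lambda>s. (norm (u s))\<^sup>2) \<longrightarrow>
        (LINT s:{0..\<tau>}|lborel. ext_semigroup T J (\<tau> - s) (B (u s))) \<in> range (blinfun_apply J))"

definition admissible_observation ::
  "(real \<Rightarrow> 'x::real_normed_vector \<Rightarrow>\<^sub>L 'x) \<Rightarrow> 'x set \<Rightarrow> ('x \<Rightarrow> 'y::euclidean_space) \<Rightarrow> bool" where
  "admissible_observation T DA C \<longleftrightarrow>
     (\<exists>\<tau>>0. \<exists>K. \<forall>x\<in>DA. (LINT s:{0..\<tau>}|lborel. (norm (C (T s x)))\<^sup>2) \<le> K * (norm x)\<^sup>2)"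

definition infinite_time_admissible ::
  "(real \<Rightarrow> 'x::real_normed_vector \<Rightarrow>\<^sub>L 'x) \<Rightarrow> 'x set \<Rightarrow> ('x \<Rightarrow> 'y::euclidean_space) \<Rightarrow> bool" where
  "infinite_time_admissible T DA C \<longleftrightarrow>
     (\<exists>K. \<forall>\<tau>>0. \<forall>x\<in>DA. (LINT s:{0..\<tau>}|lborel. (norm (C (T s x)))\<^sup>2) \<le> K * (norm x)\<^sup>2)"

text \<open>\<open>G\<close>, considered on the real resolvent set, is a transfer function of the triple \<open>(A, B, C)\<close>.
  The difference of the two extended resolvents maps into \<open>DA\<close>, so \<open>C\<close> applies to it. The triple
  determines \<open>G\<close> up to an additive constant, which regularity fixes.\<close>

definition transfer_function ::
  "'x::real_normed_vector set \<Rightarrow> ('x \<Rightarrow> 'x) \<Rightarrow> ('x \<Rightarrow>\<^sub>L 'z::banach) \<Rightarrow>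
   ('u::euclidean_space \<Rightarrow>\<^sub>L 'z) \<Rightarrow> ('x \<Rightarrow> 'y::euclidean_space) \<Rightarrow> (real \<Rightarrow> 'u \<Rightarrow>\<^sub>L 'y) \<Rightarrow> bool" where
  "transfer_function DA A J B C G \<longleftrightarrow>
     (\<forall>s\<in>resolvent_set DA A. \<forall>t\<in>resolvent_set DA A. \<forall>u.
        G s u - G t u = C (ext_resolvent DA A J s (B u) - ext_resolvent DA A J t (B u)))"

definition classical_trajectory ::
  "'x::real_normed_vector set \<Rightarrow> ('x \<Rightarrow> 'x) \<Rightarrow> ('x \<Rightarrow>\<^sub>L 'z::banach) \<Rightarrow>
   ('u::euclidean_space \<Rightarrow>\<^sub>L 'z) \<Rightarrow> (real \<Rightarrow> 'u) \<Rightarrow> (real \<Rightarrow> 'x) \<Rightarrow> bool" where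
  "classical_trajectory DA A J B u x \<longleftrightarrow>
     continuous_on {0..} u \<and>
     (\<exists>x'. continuous_on {0..} x' \<and>
        (\<forall>t\<ge>0. (x has_vector_derivative x' t) (at t within {0..}) \<and>
               J (x' t) = ext_generator DA A J (x t) + B (u t)))"

text \<open>The output \<open>y = C (x - (\<beta> - A\<^sub>-\<^sub>1)\<inverse> B u) + G(\<beta>) u\<close> of the system node, for any \<open>\<beta>\<close> in the
  resolvent set; it does not depend on \<open>\<beta>\<close> when \<open>G\<close> is a transfer function.\<close>

definition node_output ::
  "'x::real_normed_vector set \<Rightarrow> ('x \<Rightarrow> 'x) \<Rightarrow> ('x \<Rightarrow>\<^sub>L 'z::banach) \<Rightarrow>
   ('u::euclidean_space \<Rightarrow>\<^sub>L 'z) \<Rightarrow> ('x \<Rightarrow> 'y::euclidean_space) \<Rightarrow> (real \<Rightarrow> 'u \<Rightarrow>\<^sub>L 'y) \<Rightarrow>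
   real \<Rightarrow> 'x \<Rightarrow> 'u \<Rightarrow> 'y" where
  "node_output DA A J B C G \<beta> x u = C (x - ext_resolvent DA A J \<beta> (B u)) + G \<beta> u"

definition well_posed ::
  "real \<Rightarrow> (real \<Rightarrow> 'x::real_normed_vector \<Rightarrow>\<^sub>L 'x) \<Rightarrow> 'x set \<Rightarrow> ('x \<Rightarrow> 'x) \<Rightarrow>
   ('x \<Rightarrow>\<^sub>L 'z::{banach,second_countable_topology}) \<Rightarrow>
   ('u::euclidean_space \<Rightarrow>\<^sub>L 'z) \<Rightarrow> ('x \<Rightarrow> 'y::euclidean_space) \<Rightarrow> (real \<Rightarrow> 'u \<Rightarrow>\<^sub>L 'y) \<Rightarrow> bool" where
  "well_posed s0 T DA A J B C G \<longleftrightarrow>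
     generates DA A T \<and>
     extrapolation_space s0 DA A J \<and>
     bounded_on_X1 s0 DA A C \<and>
     admissible_control T J B \<and>
     admissible_observation T DA C \<and>
     transfer_function DA A J B C G \<and>
     (\<exists>\<tau>>0. \<exists>K. \<forall>u x. classical_trajectory DA A J B u x \<longrightarrow>
        (norm (x \<tau>))\<^sup>2 + (LINT t:{0..\<tau>}|lborel. (norm (node_output DA A J B C G s0 (x t) (u t)))\<^sup>2)
          \<le> K * ((norm (x 0))\<^sup>2 + (LINT t:{0..\<tau>}|lborel. (norm (u t))\<^sup>2)))"

definition regular_linear_system ::
  "real \<Rightarrow> (real \<Rightarrow> 'x::real_normed_vector \<Rightarrow>\<^sub>L 'x) \<Rightarrow> 'x set \<Rightarrow> ('x \<Rightarrow> 'x) \<Rightarrow>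
   ('x \<Rightarrow>\<^sub>L 'z::{banach,second_countable_topology}) \<Rightarrow> ('u::euclidean_space \<Rightarrow>\<^sub>L 'z) \<Rightarrow>
   ('x \<Rightarrow> 'y::euclidean_space) \<Rightarrow> ('u \<Rightarrow>\<^sub>L 'y) \<Rightarrow> (real \<Rightarrow> 'u \<Rightarrow>\<^sub>L 'y) \<Rightarrow> bool" where
  "regular_linear_system s0 T DA A J B C D G \<longleftrightarrow>
     well_posed s0 T DA A J B C G \<and>
     (\<forall>u. ((\<lambda>s. G s u) \<longlongrightarrow> D u) at_top)"

section \<open>Cayley-Tustin discretization\<close>

record (overloaded) ('x::real_normed_vector, 'u::real_normed_vector, 'y::real_normed_vector) dt_system =
  Ad :: "'x \<Rightarrow>\<^sub>L 'x"
  Bd :: "'u \<Rightarrow>\<^sub>L 'x"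
  Cd :: "'x \<Rightarrow>\<^sub>L 'y"
  Dd :: "'u \<Rightarrow>\<^sub>L 'y"

definition cayley_tustin ::
  "'x::real_normed_vector set \<Rightarrow> ('x \<Rightarrow> 'x) \<Rightarrow> ('x \<Rightarrow>\<^sub>L 'z::banach) \<Rightarrow>
   ('u::euclidean_space \<Rightarrow>\<^sub>L 'z) \<Rightarrow> ('x \<Rightarrow> 'y::euclidean_space) \<Rightarrow> (real \<Rightarrow> 'u \<Rightarrow>\<^sub>L 'y) \<Rightarrow>
   real \<Rightarrow> ('x, 'u, 'y) dt_system" where
  "cayley_tustin DA A J B C G \<delta> =
     \<lparr> Ad = - id_blinfun + (2 * \<delta>) *\<^sub>R resolvent DA A \<delta>,
       Bd = sqrt (2 * \<delta>) *\<^sub>R (ext_resolvent DA A J \<delta> o\<^sub>L B),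
       Cd = Blinfun (\<lambda>x. sqrt (2 * \<delta>) *\<^sub>R C (resolvent DA A \<delta> x)),
       Dd = G \<delta> \<rparr>"

section \<open>Weights and the Lyapunov equation\<close>

definition self_adjoint_op :: "('a::real_inner \<Rightarrow>\<^sub>L 'a) \<Rightarrow> bool" where
  "self_adjoint_op W \<longleftrightarrow> (\<forall>x y. W x \<bullet> y = x \<bullet> W y)"

definition pos_semidef :: "('a::real_inner \<Rightarrow>\<^sub>L 'a) \<Rightarrow> bool" where
  "pos_semidef W \<longleftrightarrow> self_adjoint_op W \<and> (\<forall>x. 0 \<le> x \<bullet> W x)"

definition pos_def :: "('a::real_inner \<Rightarrow>\<^sub>L 'a) \<Rightarrow> bool" where
  "pos_def W \<longleftrightarrow> self_adjoint_op W \<and> (\<forall>x. x \<noteq> 0 \<longrightarrow> 0 < x \<bullet> W x)"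

definition lyapunov_eq ::
  "('x::real_inner, 'u::real_inner, 'y::real_inner) dt_system \<Rightarrow> ('y \<Rightarrow>\<^sub>L 'y) \<Rightarrow> ('x \<Rightarrow>\<^sub>L 'x) \<Rightarrow> bool" where
  "lyapunov_eq \<Sigma> Q Qb \<longleftrightarrow>
     (\<forall>x. adjoint (blinfun_apply (Ad \<Sigma>)) (Qb (Ad \<Sigma> x)) - Qb x =
          - adjoint (blinfun_apply (Cd \<Sigma>)) (Q (Cd \<Sigma> x)))"

section \<open>The quadratic program\<close>

text \<open>An element of \<open>U\<^sup>N\<close> is a function on \<open>nat\<close> of which only the values at \<open>1, \<dots>, N\<close> matter;
  block operators are indexed by \<open>1, \<dots>, N\<close> in the same way. \<open>diag_H\<close> is the diagonal block of \<open>H\<close>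
  and \<open>low_H\<close> the block below the diagonal.\<close>

definition diag_H ::
  "('x::real_inner, 'u::real_inner, 'y::real_inner) dt_system \<Rightarrow> ('y \<Rightarrow>\<^sub>L 'y) \<Rightarrow> ('u \<Rightarrow>\<^sub>L 'u) \<Rightarrow>
   ('x \<Rightarrow>\<^sub>L 'x) \<Rightarrow> 'u \<Rightarrow> 'u" where
  "diag_H \<Sigma> Q R Qb v =
     adjoint (blinfun_apply (Dd \<Sigma>)) (Q (Dd \<Sigma> v)) +
     adjoint (blinfun_apply (Bd \<Sigma>)) (Qb (Bd \<Sigma> v)) + R v"

definition low_H ::
  "('x::real_inner, 'u::real_inner, 'y::real_inner) dt_system \<Rightarrow> ('y \<Rightarrow>\<^sub>L 'y) \<Rightarrow>
   ('x \<Rightarrow>\<^sub>L 'x) \<Rightarrow> nat \<Rightarrow> nat \<Rightarrow> 'u \<Rightarrow> 'u" where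
  "low_H \<Sigma> Q Qb i j v =
     adjoint (blinfun_apply (Dd \<Sigma>)) (Q (Cd \<Sigma> ((blinfun_apply (Ad \<Sigma>) ^^ (i - j - 1)) (Bd \<Sigma> v)))) +
     adjoint (blinfun_apply (Bd \<Sigma>)) (Qb ((blinfun_apply (Ad \<Sigma>) ^^ (i - j)) (Bd \<Sigma> v)))"

definition block_H ::
  "('x::real_inner, 'u::real_inner, 'y::real_inner) dt_system \<Rightarrow> ('y \<Rightarrow>\<^sub>L 'y) \<Rightarrow> ('u \<Rightarrow>\<^sub>L 'u) \<Rightarrow>
   ('x \<Rightarrow>\<^sub>L 'x) \<Rightarrow> nat \<Rightarrow> nat \<Rightarrow> 'u \<Rightarrow> 'u" where
  "block_H \<Sigma> Q R Qb i j =
     (if i = j then diag_H \<Sigma> Q R Qb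
      else if j < i then low_H \<Sigma> Q Qb i j
      else adjoint (low_H \<Sigma> Q Qb j i))"

definition op_H ::
  "('x::real_inner, 'u::real_inner, 'y::real_inner) dt_system \<Rightarrow> ('y \<Rightarrow>\<^sub>L 'y) \<Rightarrow> ('u \<Rightarrow>\<^sub>L 'u) \<Rightarrow>
   ('x \<Rightarrow>\<^sub>L 'x) \<Rightarrow> nat \<Rightarrow> (nat \<Rightarrow> 'u) \<Rightarrow> nat \<Rightarrow> 'u" where
  "op_H \<Sigma> Q R Qb N V i = (\<Sum>j=1..N. block_H \<Sigma> Q R Qb i j (V j))"

definition op_P ::
  "('x::real_inner, 'u::real_inner, 'y::real_inner) dt_system \<Rightarrow> ('y \<Rightarrow>\<^sub>L 'y) \<Rightarrow>
   ('x \<Rightarrow>\<^sub>L 'x) \<Rightarrow> 'x \<Rightarrow> nat \<Rightarrow> 'u" where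
  "op_P \<Sigma> Q Qb x n =
     adjoint (blinfun_apply (Dd \<Sigma>)) (Q (Cd \<Sigma> ((blinfun_apply (Ad \<Sigma>) ^^ (n - 1)) x))) +
     adjoint (blinfun_apply (Bd \<Sigma>)) (Qb ((blinfun_apply (Ad \<Sigma>) ^^ n) x))"

definition block_S ::
  "('x::real_normed_vector, 'u::real_normed_vector, 'y::real_normed_vector) dt_system \<Rightarrow>
   nat \<Rightarrow> nat \<Rightarrow> 'u \<Rightarrow> 'y" where
  "block_S \<Sigma> i j v =
     (if i = j then Dd \<Sigma> v
      else if j < i then Cd \<Sigma> ((blinfun_apply (Ad \<Sigma>) ^^ (i - j - 1)) (Bd \<Sigma> v))
      else 0)"

definition op_S ::
  "('x::real_normed_vector, 'u::real_normed_vector, 'y::real_normed_vector) dt_system \<Rightarrow>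
   nat \<Rightarrow> (nat \<Rightarrow> 'u) \<Rightarrow> nat \<Rightarrow> 'y" where
  "op_S \<Sigma> N V i = (\<Sum>j=1..N. block_S \<Sigma> i j (V j))"

definition op_T ::
  "('x::real_normed_vector, 'u::real_normed_vector, 'y::real_normed_vector) dt_system \<Rightarrow>
   'x \<Rightarrow> nat \<Rightarrow> 'y" where
  "op_T \<Sigma> x n = Cd \<Sigma> ((blinfun_apply (Ad \<Sigma>) ^^ (n - 1)) x)"

definition cost_J ::
  "('x::real_inner, 'u::real_inner, 'y::real_inner) dt_system \<Rightarrow> ('y \<Rightarrow>\<^sub>L 'y) \<Rightarrow> ('u \<Rightarrow>\<^sub>L 'u) \<Rightarrow>
   ('x \<Rightarrow>\<^sub>L 'x) \<Rightarrow> nat \<Rightarrow> (nat \<Rightarrow> 'u) \<Rightarrow> 'x \<Rightarrow> real" where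
  "cost_J \<Sigma> Q R Qb N V x =
     (\<Sum>i=1..N. V i \<bullet> op_H \<Sigma> Q R Qb N V i) + 2 * (\<Sum>i=1..N. V i \<bullet> op_P \<Sigma> Q Qb x i)"

text \<open>On \<open>real ^ 'm\<close> the relation \<open>\<le>\<close> is the componentwise order.\<close>

definition qp_constraints ::
  "('x::real_normed_vector, real^'m, real^'p) dt_system \<Rightarrow> nat \<Rightarrow>
   real^'m \<Rightarrow> real^'m \<Rightarrow> real^'p \<Rightarrow> real^'p \<Rightarrow> 'x \<Rightarrow> (nat \<Rightarrow> real^'m) \<Rightarrow> bool" where
  "qp_constraints \<Sigma> N umin umax ymin ymax x V \<longleftrightarrow>
     (\<forall>i\<in>{1..N}. umin \<le> V i \<and> V i \<le> umax \<and>
        ymin \<le> op_S \<Sigma> N V i + op_T \<Sigma> x i \<and> op_S \<Sigma> N V i + op_T \<Sigma> x i \<le> ymax)"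

definition qp_solution ::
  "('x::real_inner, real^'m, real^'p) dt_system \<Rightarrow>
   ((real^'p) \<Rightarrow>\<^sub>L (real^'p)) \<Rightarrow> ((real^'m) \<Rightarrow>\<^sub>L (real^'m)) \<Rightarrow> ('x \<Rightarrow>\<^sub>L 'x) \<Rightarrow> nat \<Rightarrow>
   real^'m \<Rightarrow> real^'m \<Rightarrow> real^'p \<Rightarrow> real^'p \<Rightarrow> 'x \<Rightarrow> (nat \<Rightarrow> real^'m) \<Rightarrow> bool" where
  "qp_solution \<Sigma> Q R Qb N umin umax ymin ymax x V \<longleftrightarrow>
     qp_constraints \<Sigma> N umin umax ymin ymax x V \<and>
     (\<forall>W. qp_constraints \<Sigma> N umin umax ymin ymax x W \<longrightarrow>
          cost_J \<Sigma> Q R Qb N V x \<le> cost_J \<Sigma> Q R Qb N W x)"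

section \<open>Feasibility and the control scheme\<close>

primrec dt_state ::
  "('x::real_normed_vector, 'u::real_normed_vector, 'y::real_normed_vector) dt_system \<Rightarrow>
   'x \<Rightarrow> (nat \<Rightarrow> 'u) \<Rightarrow> nat \<Rightarrow> 'x" where
  "dt_state \<Sigma> x v 0 = x"
| "dt_state \<Sigma> x v (Suc j) = Ad \<Sigma> (dt_state \<Sigma> x v j) + Bd \<Sigma> (v (Suc j))"

definition dt_output ::
  "('x::real_normed_vector, 'u::real_normed_vector, 'y::real_normed_vector) dt_system \<Rightarrow>
   'x \<Rightarrow> (nat \<Rightarrow> 'u) \<Rightarrow> nat \<Rightarrow> 'y" where
  "dt_output \<Sigma> x v j = Cd \<Sigma> (dt_state \<Sigma> x v (j - 1)) + Dd \<Sigma> (v j)"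

text \<open>The plan \<open>V\<close>, with zero input beyond the horizon, is feasible for the infinite-horizon problem
  started in \<open>x\<close>. For \<open>j \<le> N\<close> the bounds below are those of \<open>qp_constraints\<close>. The bounds for
  \<open>j > N\<close> do not follow from them: without these bounds the plan moved on by one step need not
  satisfy the constraints of the next quadratic program, and the inputs need not converge to zero.\<close>

definition zero_tail :: "nat \<Rightarrow> (nat \<Rightarrow> 'u::zero) \<Rightarrow> nat \<Rightarrow> 'u" where
  "zero_tail N V j = (if j \<le> N then V j else 0)"

definition infinite_horizon_feasible ::
  "('x::real_normed_vector, real^'m, real^'p) dt_system \<Rightarrow> nat \<Rightarrow>
   real^'m \<Rightarrow> real^'m \<Rightarrow> real^'p \<Rightarrow> real^'p \<Rightarrow> 'x \<Rightarrow> (nat \<Rightarrow> real^'m) \<Rightarrow> bool" where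
  "infinite_horizon_feasible \<Sigma> N umin umax ymin ymax x V \<longleftrightarrow>
     (\<forall>j\<ge>1. umin \<le> zero_tail N V j \<and> zero_tail N V j \<le> umax \<and>
        ymin \<le> dt_output \<Sigma> x (zero_tail N V) j \<and> dt_output \<Sigma> x (zero_tail N V) j \<le> ymax)"

definition mpc_run ::
  "('x::real_inner, real^'m, real^'p) dt_system \<Rightarrow>
   ((real^'p) \<Rightarrow>\<^sub>L (real^'p)) \<Rightarrow> ((real^'m) \<Rightarrow>\<^sub>L (real^'m)) \<Rightarrow> ('x \<Rightarrow>\<^sub>L 'x) \<Rightarrow> nat \<Rightarrow>
   real^'m \<Rightarrow> real^'m \<Rightarrow> real^'p \<Rightarrow> real^'p \<Rightarrow> 'x \<Rightarrow>
   (nat \<Rightarrow> 'x) \<Rightarrow> (nat \<Rightarrow> nat \<Rightarrow> real^'m) \<Rightarrow> (nat \<Rightarrow> real^'m) \<Rightarrow> bool" where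
  "mpc_run \<Sigma> Q R Qb N umin umax ymin ymax x0 x U u \<longleftrightarrow>
     x 0 = x0 \<and>
     (\<forall>k. qp_solution \<Sigma> Q R Qb N umin umax ymin ymax (x k) (U k) \<and>
          u (Suc k) = U k 1 \<and>
          x (Suc k) = Ad \<Sigma> (x k) + Bd \<Sigma> (u (Suc k)))"

end

theory Submission
  imports Defs
begin

text \<open>Measure a plan by its stage costs plus the terminal weight \<open>Qb\<close>. The Lyapunov equation turns the
  quadratic program into the minimization of this cost and makes the terminal weight the exact cost of
  running on with zero input. So the plan moved on by one step, with a zero appended, costs at most
  as much as the previous optimum, and it is feasible because the plan satisfied the constraints
  beyond the horizon. The optimal costs therefore decrease to a limit. As the cost is strongly convex
  (\<open>R\<close> is coercive), the distance between the new optimum and the shifted old one is bounded by the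
  decrease, so \<open>U (k + 1) i - U k (i + 1)\<close> tends to zero, where \<open>U k (N + 1)\<close> is read as \<open>0\<close>. Going
  down from \<open>i = N\<close>, every component tends to zero.\<close>

section \<open>Adjoints on Hilbert spaces\<close>

text \<open>If \<open>z\<close> represents \<open>f\<close>, then
  \<open>y \<bullet> y - 2 * f y\<close> is the squared distance from \<open>y\<close> to
  \<open>z\<close> up to a constant. So \<open>z\<close> is sought as the minimizer of this
  functional, and completeness supplies it.\<close>

lemma riesz_representation:
  fixes f :: "'a::{real_inner,banach} \<Rightarrow> real"
  assumes "bounded_linear f"
  shows "\<exists>z. \<forall>x. f x = z \<bullet> x"
proof -
  interpret bounded_linear f by fact
  obtain K where K: "\<And>x. norm (f x) \<le> norm x * K" using bounded by blast
  define g where "g y = y \<bullet> y - 2 * f y" for y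
  have lower: "- K\<^sup>2 \<le> g y" for y
  proof -
    have "2 * f y \<le> 2 * (norm y * K)" using K[of y] by simp
    also have "\<dots> \<le> (norm y)\<^sup>2 + K\<^sup>2" using sum_squares_bound[of "norm y" K] by simp
    finally show ?thesis by (simp add: g_def power2_norm_eq_inner)
  qed
  define m where "m = Inf (range g)"
  have bdd: "bdd_below (range g)" using lower by (intro bdd_belowI2)
  have m_le: "m \<le> g y" for y unfolding m_def using bdd by (intro cInf_lower) auto
  have "\<exists>y. g y < m + 1 / Suc n" for n
  proof -
    have "Inf (range g) < m + 1 / Suc n" by (simp add: m_def)
    then show ?thesis using cInf_lessD[of "range g" "m + 1 / Suc n"] by auto
  qed
  then obtain Y where Y: "\<And>n. g (Y n) < m + 1 / Suc n" by metis
  \<comment> \<open>Parallelogram law: the linear part of \<open>g\<close> cancels, so two nearly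
    minimal points are close. This makes \<open>Y\<close> a Cauchy sequence.\<close>
  have mid: "(norm (a - b))\<^sup>2 \<le> 2 * (g a - m) + 2 * (g b - m)" for a b
  proof -
    define c where "c = (1/2) *\<^sub>R (a + b)"
    have "4 * g c = 2 * g a + 2 * g b - (norm (a - b))\<^sup>2"
      by (simp add: c_def g_def power2_norm_eq_inner add scaleR inner_simps inner_commute algebra_simps)
    then show ?thesis using m_le[of c] by argo
  qed
  have "Cauchy Y"
  proof (rule metric_CauchyI)
    fix e :: real assume "0 < e"
    then obtain M where M: "1 / Suc M < e\<^sup>2 / 4" using nat_approx_posE[of "e\<^sup>2 / 4"] by auto
    have "dist (Y p) (Y q) < e" if "p \<ge> M" "q \<ge> M" for p q
    proof -
      have close: "g (Y n) - m < e\<^sup>2 / 4" if "n \<ge> M" for n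
      proof -
        have "1 / Suc n \<le> 1 / Suc M" using that by (simp add: frac_le)
        then show ?thesis using Y[of n] M by linarith
      qed
      then have "(norm (Y p - Y q))\<^sup>2 < e\<^sup>2" using mid[of "Y p" "Y q"] close[OF that(1)] close[OF that(2)] by argo
      then show ?thesis using \<open>0 < e\<close> by (simp add: dist_norm power2_less_imp_less)
    qed
    then show "\<exists>M. \<forall>p\<ge>M. \<forall>q\<ge>M. dist (Y p) (Y q) < e" by blast
  qed
  then obtain z where z: "Y \<longlonglongrightarrow> z" using Cauchy_convergent convergent_def by blast
  have "(\<lambda>n. g (Y n)) \<longlonglongrightarrow> g z"
    unfolding g_def by (intro tendsto_intros tendsto z)
  moreover have "(\<lambda>n. m + 1 / Suc n) \<longlonglongrightarrow> m"
    using tendsto_add[OF tendsto_const LIMSEQ_inverse_real_of_nat, of m] by (simp add: inverse_eq_divide)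
  ultimately have "g z \<le> m" by (rule LIMSEQ_le) (use Y less_imp_le in blast)
  then have min: "g z \<le> g y" for y using m_le order_trans by blast
  have "f x = z \<bullet> x" for x
  proof (rule ccontr)
    assume ne: "f x \<noteq> z \<bullet> x"
    define d where "d = f x - z \<bullet> x"
    have d: "d \<noteq> 0" using ne by (simp add: d_def)
    have x: "x \<bullet> x > 0" using ne by (auto simp: zero)
    \<comment> \<open>This \<open>t\<close> minimizes \<open>g\<close> on the line through
      \<open>z\<close> in direction \<open>x\<close>; there \<open>g\<close> drops by the square of
      \<open>d\<close> over \<open>x \<bullet> x\<close>.\<close>
    define t where "t = d / (x \<bullet> x)"
    have "g (z + t *\<^sub>R x) = g z + t * t * (x \<bullet> x) - 2 * t * d"
      by (simp add: g_def d_def add scaleR inner_simps inner_commute algebra_simps)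
    also have "\<dots> = g z - d\<^sup>2 / (x \<bullet> x)"
      using x by (simp add: t_def field_simps power2_eq_square)
    also have "\<dots> < g z" using x d by simp
    finally show False using min[of "z + t *\<^sub>R x"] by simp
  qed
  then show ?thesis by blast
qed

text \<open>The library has this for Euclidean spaces only; \<open>adjoint\<close> is a \<open>SOME\<close> term, so existence has
  to be supplied.\<close>

lemma inner_adjoint:
  fixes f :: "'a::{real_inner,banach} \<Rightarrow> 'b::real_inner"
  assumes "bounded_linear f"
  shows "x \<bullet> adjoint f y = f x \<bullet> y"
proof -
  have "\<exists>z. \<forall>x. f x \<bullet> y = z \<bullet> x" for y
    using riesz_representation[of "\<lambda>x. f x \<bullet> y"] assms
    by (auto intro: bounded_linear_compose[OF bounded_linear_inner_left])
  then obtain g where "\<And>x y. f x \<bullet> y = g y \<bullet> x" by metis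
  then have "\<exists>g. \<forall>x y. f x \<bullet> y = x \<bullet> g y" by (metis inner_commute)
  then have "\<forall>x y. f x \<bullet> y = x \<bullet> adjoint f y" unfolding adjoint_def by (rule someI_ex)
  then show ?thesis by simp
qed

section \<open>Quadratic forms\<close>

lemma pos_def_imp_pos_semidef: "pos_def W \<Longrightarrow> pos_semidef W"
  unfolding pos_def_def pos_semidef_def by (metis inner_zero_left less_imp_le order_refl)

lemma pos_semidef_nonneg: "pos_semidef W \<Longrightarrow> 0 \<le> x \<bullet> blinfun_apply W x"
  by (simp add: pos_semidef_def)

lemma quadratic_form_add:
  assumes "self_adjoint_op W"
  shows "(a + b) \<bullet> blinfun_apply W (a + b) = a \<bullet> W a + 2 * (b \<bullet> W a) + b \<bullet> W b"
  using assms unfolding self_adjoint_op_def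
  by (simp add: blinfun.add_right inner_add_left inner_add_right) (metis inner_commute)

text \<open>Parallelogram identity for the form of \<open>W\<close>. The subtracted term is kept
  because it becomes the strong convexity gained from \<open>R\<close>.\<close>

lemma quadratic_form_midpoint:
  assumes "self_adjoint_op W"
  shows "((1/2) *\<^sub>R (a + b)) \<bullet> blinfun_apply W ((1/2) *\<^sub>R (a + b)) =
    (a \<bullet> W a + b \<bullet> W b) / 2 - ((a - b) \<bullet> W (a - b)) / 4"
proof -
  define c where "c = a + b"
  have "((1/2) *\<^sub>R c) \<bullet> W ((1/2) *\<^sub>R c) = (c \<bullet> W c) / 4"
    by (simp add: blinfun.scaleR_right)
  moreover have "(a - b) \<bullet> W (a - b) = a \<bullet> W a - 2 * (b \<bullet> W a) + b \<bullet> W b"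
    using quadratic_form_add[OF assms, of a "- b"] by (simp add: blinfun.minus_right)
  ultimately show ?thesis using quadratic_form_add[OF assms, of a b] unfolding c_def by argo
qed

lemma quadratic_form_midpoint_le:
  assumes "pos_semidef W"
  shows "((1/2) *\<^sub>R (a + b)) \<bullet> blinfun_apply W ((1/2) *\<^sub>R (a + b)) \<le> (a \<bullet> W a + b \<bullet> W b) / 2"
proof -
  have "self_adjoint_op W" using assms by (simp add: pos_semidef_def)
  from quadratic_form_midpoint[OF this, of a b] pos_semidef_nonneg[OF assms, of "a - b"]
  show ?thesis by linarith
qed

text \<open>In finite dimension the form attains its minimum on the compact unit sphere; positivity
  there and homogeneity give the constant.\<close>

lemma pos_def_coercive:
  fixes W :: "'a::euclidean_space \<Rightarrow>\<^sub>L 'a"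
  assumes "pos_def W"
  obtains r where "r > 0" "\<And>v. r * (norm v)\<^sup>2 \<le> v \<bullet> W v"
proof -
  obtain b :: 'a where b: "b \<in> Basis" using nonempty_Basis by blast
  then have "sphere 0 1 \<noteq> ({} :: 'a set)" by (auto intro!: exI[of _ b])
  moreover have "continuous_on (sphere 0 1) (\<lambda>v. v \<bullet> W v)" by (intro continuous_intros)
  ultimately obtain w where w: "w \<in> sphere 0 1" "\<And>v. v \<in> sphere 0 1 \<Longrightarrow> w \<bullet> W w \<le> v \<bullet> W v"
    using continuous_attains_inf[OF compact_sphere] by metis
  have "w \<noteq> 0" using w(1) by auto
  then have pos: "0 < w \<bullet> W w" using assms by (simp add: pos_def_def)
  have "(w \<bullet> W w) * (norm v)\<^sup>2 \<le> v \<bullet> W v" for v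
  proof (cases "v = 0")
    case False
    then have "sgn v \<in> sphere 0 1" by (simp add: norm_sgn)
    then have "w \<bullet> W w \<le> sgn v \<bullet> W (sgn v)" by (rule w)
    also have "\<dots> = (v \<bullet> W v) / (norm v)\<^sup>2"
      by (simp add: sgn_div_norm blinfun.scaleR_right power2_eq_square divide_inverse algebra_simps)
    finally show ?thesis using False by (simp add: field_simps)
  qed simp
  with pos that show ?thesis by blast
qed

section \<open>Trajectories of the discrete-time system\<close>

lemma dt_state_cong:
  assumes "\<And>i. i \<in> {1..n} \<Longrightarrow> v i = w i"
  shows "dt_state \<Sigma> x v n = dt_state \<Sigma> x w n"
  using assms by (induction n) auto

lemma dt_output_cong:
  assumes "\<And>i. i \<in> {1..n} \<Longrightarrow> v i = w i" "n \<ge> 1"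
  shows "dt_output \<Sigma> x v n = dt_output \<Sigma> x w n"
proof -
  have "dt_state \<Sigma> x v (n - 1) = dt_state \<Sigma> x w (n - 1)" by (rule dt_state_cong) (use assms(1) in auto)
  then show ?thesis using assms by (simp add: dt_output_def)
qed

text \<open>Time invariance. It identifies the trajectory of the plan moved on by one step with the
  tail of the old trajectory.\<close>

lemma dt_state_shift:
  "dt_state \<Sigma> (dt_state \<Sigma> x v (Suc 0)) (\<lambda>i. v (Suc i)) n = dt_state \<Sigma> x v (Suc n)"
  by (induction n) auto

lemma dt_output_shift:
  "n \<ge> 1 \<Longrightarrow> dt_output \<Sigma> (dt_state \<Sigma> x v (Suc 0)) (\<lambda>i. v (Suc i)) n = dt_output \<Sigma> x v (Suc n)"
  using dt_state_shift[of \<Sigma> x v "n - 1"] by (simp add: dt_output_def)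

text \<open>With a common initial state the trajectory is affine in the input, so midpoints are
  preserved.\<close>

lemma dt_state_midpoint:
  "dt_state \<Sigma> x (\<lambda>i. (1/2) *\<^sub>R (v i + w i)) n = (1/2) *\<^sub>R (dt_state \<Sigma> x v n + dt_state \<Sigma> x w n)"
  by (induction n) (simp_all add: blinfun.add_right blinfun.scaleR_right algebra_simps flip: scaleR_2)

lemma dt_output_midpoint:
  "dt_output \<Sigma> x (\<lambda>i. (1/2) *\<^sub>R (v i + w i)) n = (1/2) *\<^sub>R (dt_output \<Sigma> x v n + dt_output \<Sigma> x w n)"
  unfolding dt_output_def dt_state_midpoint
  by (simp add: blinfun.add_right blinfun.scaleR_right algebra_simps)

text \<open>Discrete variation of constants formula; the entries of \<open>op_S\<close>,
  \<open>op_T\<close>, \<open>op_P\<close> and \<open>op_H\<close> are matched against it.\<close>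

lemma dt_state_eq:
  "dt_state \<Sigma> x v n =
     (blinfun_apply (Ad \<Sigma>) ^^ n) x + (\<Sum>i=1..n. (blinfun_apply (Ad \<Sigma>) ^^ (n - i)) (Bd \<Sigma> (v i)))"
proof (induction n)
  case (Suc n)
  have "Ad \<Sigma> (\<Sum>i=1..n. (blinfun_apply (Ad \<Sigma>) ^^ (n - i)) (Bd \<Sigma> (v i))) =
      (\<Sum>i=1..n. (blinfun_apply (Ad \<Sigma>) ^^ (Suc n - i)) (Bd \<Sigma> (v i)))"
    unfolding blinfun.sum_right by (intro sum.cong) (auto simp: Suc_diff_le)
  with Suc show ?case by (simp add: blinfun.add_right)
qed simp

lemma sum_split_diagonal:
  fixes f :: "nat \<Rightarrow> 'a::comm_monoid_add"
  assumes "i \<in> {1..N}"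
  shows "(\<Sum>j=1..N. f j) = (\<Sum>j=1..<i. f j) + f i + (\<Sum>j=Suc i..N. f j)"
proof -
  have "{1..N} = insert i {1..<i} \<union> {Suc i..N}" using assms by auto
  moreover have "sum f (insert i {1..<i} \<union> {Suc i..N}) = sum f (insert i {1..<i}) + sum f {Suc i..N}"
    by (rule sum.union_disjoint) auto
  ultimately show ?thesis by (simp add: add.commute)
qed

lemma dt_output_eq:
  assumes "i \<in> {1..N}"
  shows "op_S \<Sigma> N V i + op_T \<Sigma> x i = dt_output \<Sigma> x V i"
proof -
  \<comment> \<open>The output at time \<open>i\<close> reads the state at time
    \<open>i - 1\<close>, which depends exactly on the inputs with index below
    \<open>i\<close>.\<close>
  have *: "{Suc 0..i - Suc 0} = {Suc 0..<i}" using assms by auto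
  have "op_S \<Sigma> N V i = (\<Sum>j=1..<i. block_S \<Sigma> i j (V j)) + Dd \<Sigma> (V i)"
    unfolding op_S_def sum_split_diagonal[OF assms] by (simp add: block_S_def)
  also have "(\<Sum>j=1..<i. block_S \<Sigma> i j (V j)) =
      Cd \<Sigma> (\<Sum>j=1..<i. (blinfun_apply (Ad \<Sigma>) ^^ (i - 1 - j)) (Bd \<Sigma> (V j)))"
    unfolding blinfun.sum_right by (intro sum.cong) (auto simp: block_S_def diff_commute)
  finally show ?thesis
    by (simp add: dt_output_def dt_state_eq op_T_def * blinfun.add_right)
qed

lemma qp_constraints_iff:
  "qp_constraints \<Sigma> N umin umax ymin ymax x V \<longleftrightarrow>
    (\<forall>i\<in>{1..N}. umin \<le> V i \<and> V i \<le> umax \<and>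
       ymin \<le> dt_output \<Sigma> x V i \<and> dt_output \<Sigma> x V i \<le> ymax)"
  unfolding qp_constraints_def by (intro ball_cong refl) (simp add: dt_output_eq)

section \<open>The cost of a plan\<close>

text \<open>Under the Lyapunov equation this is \<open>cost_J\<close> plus
  \<open>x \<bullet> Qb x\<close>. It is written along the trajectory because shifts and midpoints
  act simply there.\<close>

definition plan_cost ::
  "('x::real_inner, 'u::real_inner, 'y::real_inner) dt_system \<Rightarrow> ('y \<Rightarrow>\<^sub>L 'y) \<Rightarrow> ('u \<Rightarrow>\<^sub>L 'u) \<Rightarrow>
   ('x \<Rightarrow>\<^sub>L 'x) \<Rightarrow> nat \<Rightarrow> 'x \<Rightarrow> (nat \<Rightarrow> 'u) \<Rightarrow> real" where
  "plan_cost \<Sigma> Q R Qb N x v =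
     (\<Sum>j=1..N. dt_output \<Sigma> x v j \<bullet> Q (dt_output \<Sigma> x v j) + v j \<bullet> R (v j)) +
     dt_state \<Sigma> x v N \<bullet> Qb (dt_state \<Sigma> x v N)"

text \<open>Pairing the equation with \<open>z\<close> removes both adjoints. A step with zero input
  thus lowers the \<open>Qb\<close> form by exactly the stage cost.\<close>

lemma lyapunov_eq_quadratic:
  fixes \<Sigma> :: "('x::{real_inner,banach}, 'u::real_inner, 'y::real_inner) dt_system"
  assumes "lyapunov_eq \<Sigma> Q Qb"
  shows "Ad \<Sigma> z \<bullet> Qb (Ad \<Sigma> z) + Cd \<Sigma> z \<bullet> Q (Cd \<Sigma> z) = z \<bullet> Qb z"
proof -
  have "z \<bullet> (adjoint (blinfun_apply (Ad \<Sigma>)) (Qb (Ad \<Sigma> z)) - Qb z) =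
      z \<bullet> - adjoint (blinfun_apply (Cd \<Sigma>)) (Q (Cd \<Sigma> z))"
    using assms by (simp add: lyapunov_eq_def)
  then show ?thesis
    by (simp add: inner_diff_right inner_adjoint blinfun.bounded_linear_right)
qed

text \<open>By the Lyapunov equation the parts quadratic in \<open>z\<close> cancel.\<close>

lemma stage_cost_eq:
  fixes \<Sigma> :: "('x::{real_inner,banach}, 'u::{real_inner,banach}, 'y::real_inner) dt_system"
  assumes "lyapunov_eq \<Sigma> Q Qb" "self_adjoint_op Q" "self_adjoint_op Qb"
  shows "(Cd \<Sigma> z + Dd \<Sigma> v) \<bullet> Q (Cd \<Sigma> z + Dd \<Sigma> v) + v \<bullet> blinfun_apply R v +
      (Ad \<Sigma> z + Bd \<Sigma> v) \<bullet> Qb (Ad \<Sigma> z + Bd \<Sigma> v) =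
    z \<bullet> Qb z + v \<bullet> diag_H \<Sigma> Q R Qb v + 2 * (v \<bullet> op_P \<Sigma> Q Qb z 1)"
  unfolding quadratic_form_add[OF assms(2)] quadratic_form_add[OF assms(3)]
  using lyapunov_eq_quadratic[OF assms(1), of z]
  by (simp add: diag_H_def op_P_def inner_add_right inner_adjoint blinfun.bounded_linear_right)

section \<open>Expansion of the plan cost into the block operators\<close>

lemma plan_cost_eq_sum:
  fixes \<Sigma> :: "('x::{real_inner,banach}, 'u::{real_inner,banach}, 'y::real_inner) dt_system"
  assumes "lyapunov_eq \<Sigma> Q Qb" "self_adjoint_op Q" "self_adjoint_op Qb"
  shows "plan_cost \<Sigma> Q R Qb N x v = x \<bullet> Qb x +
    (\<Sum>i=1..N. v i \<bullet> diag_H \<Sigma> Q R Qb (v i) + 2 * (v i \<bullet> op_P \<Sigma> Q Qb (dt_state \<Sigma> x v (i - 1)) 1))"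
proof (induction N)
  case (Suc N)
  then show ?case
    \<comment> \<open>The terminal weight at time \<open>Suc N\<close> is traded for the one at time
      \<open>N\<close>, so it telescopes back to the initial state.\<close>
    using stage_cost_eq[OF assms, of "dt_state \<Sigma> x v N" "v (Suc N)" R]
    by (simp add: plan_cost_def dt_output_def)
qed (simp add: plan_cost_def)

text \<open>Paired with \<open>w\<close>, \<open>op_P\<close> at index 1 is a linear functional
  \<open>L\<close> of the state. In the variation of constants formula the initial state yields
  \<open>op_P\<close> at index \<open>i\<close>, and each earlier input yields a block below the
  diagonal of \<open>H\<close>.\<close>

lemma op_P_dt_state:
  fixes \<Sigma> :: "('x::{real_inner,banach}, 'u::{real_inner,banach}, 'y::real_inner) dt_system"
  assumes "i \<ge> 1"
  shows "w \<bullet> op_P \<Sigma> Q Qb (dt_state \<Sigma> x v (i - 1)) 1 =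
    w \<bullet> op_P \<Sigma> Q Qb x i + (\<Sum>j=1..<i. w \<bullet> low_H \<Sigma> Q Qb i j (v j))"
proof -
  define L where "L z = Dd \<Sigma> w \<bullet> Q (Cd \<Sigma> z) + Bd \<Sigma> w \<bullet> Qb (Ad \<Sigma> z)" for z
  have L_add: "L (a + b) = L a + L b" for a b
    by (simp add: L_def blinfun.add_right inner_add_right)
  have L_sum: "L (sum f S) = (\<Sum>j\<in>S. L (f j))" for f :: "nat \<Rightarrow> 'x" and S
    by (simp add: L_def blinfun.sum_right inner_sum_right sum.distrib)
  have P: "w \<bullet> op_P \<Sigma> Q Qb z n = L ((blinfun_apply (Ad \<Sigma>) ^^ (n - 1)) z)" if "n \<ge> 1" for z n
  proof -
    obtain k where "n = Suc k" using \<open>n \<ge> 1\<close> by (cases n) auto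
    then show ?thesis
      by (simp add: op_P_def L_def inner_add_right inner_adjoint blinfun.bounded_linear_right)
  qed
  have H: "w \<bullet> low_H \<Sigma> Q Qb i j y = L ((blinfun_apply (Ad \<Sigma>) ^^ (i - 1 - j)) (Bd \<Sigma> y))" if "j < i" for j y
  proof -
    \<comment> \<open>The second term of \<open>low_H\<close> has one more factor \<open>Ad\<close>
      than the first, as \<open>L\<close> demands.\<close>
    have "i - j = Suc (i - 1 - j)" using that by simp
    then show ?thesis
      by (simp add: low_H_def L_def inner_add_right inner_adjoint blinfun.bounded_linear_right)
  qed
  have *: "{Suc 0..i - Suc 0} = {Suc 0..<i}" using assms by auto
  have "w \<bullet> op_P \<Sigma> Q Qb (dt_state \<Sigma> x v (i - 1)) 1 = L (dt_state \<Sigma> x v (i - 1))" by (simp add: P)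
  also have "\<dots> = w \<bullet> op_P \<Sigma> Q Qb x i +
      (\<Sum>j=1..<i. L ((blinfun_apply (Ad \<Sigma>) ^^ (i - 1 - j)) (Bd \<Sigma> (v j))))"
    using assms by (simp add: dt_state_eq L_add L_sum P *)
  finally show ?thesis by (simp add: H)
qed

text \<open>Both sides sum over the pairs \<open>i < j\<close> up to \<open>N\<close>. This folds
  the blocks above the diagonal onto those below.\<close>

lemma sum_triangle_swap:
  fixes f :: "nat \<Rightarrow> nat \<Rightarrow> 'a::comm_monoid_add"
  shows "(\<Sum>i=1..N. \<Sum>j=Suc i..N. f i j) = (\<Sum>j=1..N. \<Sum>i=1..<j. f i j)"
proof -
  have "(\<Sum>i=1..N. \<Sum>j | j \<in> {1..N} \<and> i < j. f i j) = (\<Sum>j=1..N. \<Sum>i | i \<in> {1..N} \<and> i < j. f i j)"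
    by (rule sum.swap_restrict) auto
  moreover have "{j. j \<in> {1..N} \<and> i < j} = {Suc i..N}" if "i \<in> {1..N}" for i using that by auto
  moreover have "{i. i \<in> {1..N} \<and> i < j} = {1..<j}" if "j \<in> {1..N}" for j using that by auto
  ultimately show ?thesis by simp
qed

text \<open>Needed to move the adjoint in the blocks of \<open>H\<close> above the diagonal.
  Linearity is checked through inner products, which remove the adjoints inside
  \<open>low_H\<close>; boundedness then comes from finite dimension.\<close>

lemma bounded_linear_low_H:
  fixes \<Sigma> :: "('x::{real_inner,banach}, 'u::euclidean_space, 'y::real_inner) dt_system"
  shows "bounded_linear (low_H \<Sigma> Q Qb i j)"
proof -
  have pow_add: "(blinfun_apply (Ad \<Sigma>) ^^ n) (a + b) =
      (blinfun_apply (Ad \<Sigma>) ^^ n) a + (blinfun_apply (Ad \<Sigma>) ^^ n) b" for n a b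
    by (induction n) (simp_all add: blinfun.add_right)
  have pow_scaleR: "(blinfun_apply (Ad \<Sigma>) ^^ n) (r *\<^sub>R a) = r *\<^sub>R (blinfun_apply (Ad \<Sigma>) ^^ n) a" for n r a
    by (induction n) (simp_all add: blinfun.scaleR_right)
  have inner_low_H: "w \<bullet> low_H \<Sigma> Q Qb i j v =
      Dd \<Sigma> w \<bullet> Q (Cd \<Sigma> ((blinfun_apply (Ad \<Sigma>) ^^ (i - j - 1)) (Bd \<Sigma> v))) +
      Bd \<Sigma> w \<bullet> Qb ((blinfun_apply (Ad \<Sigma>) ^^ (i - j)) (Bd \<Sigma> v))" for v w
    by (simp add: low_H_def inner_add_right inner_adjoint blinfun.bounded_linear_right)
  have "linear (low_H \<Sigma> Q Qb i j)"
  proof (rule linearI)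
    fix a b :: 'u and r :: real
    have "w \<bullet> low_H \<Sigma> Q Qb i j (a + b) = w \<bullet> (low_H \<Sigma> Q Qb i j a + low_H \<Sigma> Q Qb i j b)" for w
      by (simp add: inner_add_right inner_low_H blinfun.add_right pow_add)
    then show "low_H \<Sigma> Q Qb i j (a + b) = low_H \<Sigma> Q Qb i j a + low_H \<Sigma> Q Qb i j b"
      using vector_eq_ldot by blast
    have "w \<bullet> low_H \<Sigma> Q Qb i j (r *\<^sub>R a) = w \<bullet> (r *\<^sub>R low_H \<Sigma> Q Qb i j a)" for w
      by (simp add: inner_low_H blinfun.scaleR_right pow_scaleR algebra_simps)
    then show "low_H \<Sigma> Q Qb i j (r *\<^sub>R a) = r *\<^sub>R low_H \<Sigma> Q Qb i j a"
      using vector_eq_ldot by blast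
  qed
  then show ?thesis by (rule linear_conv_bounded_linear[THEN iffD1])
qed

text \<open>A block above the diagonal is the adjoint of its mirror image, so each product below the
  diagonal is counted twice.\<close>

lemma inner_op_H:
  fixes \<Sigma> :: "('x::{real_inner,banach}, 'u::euclidean_space, 'y::real_inner) dt_system"
  shows "(\<Sum>i=1..N. V i \<bullet> op_H \<Sigma> Q R Qb N V i) =
    (\<Sum>i=1..N. V i \<bullet> diag_H \<Sigma> Q R Qb (V i) + 2 * (\<Sum>j=1..<i. V i \<bullet> low_H \<Sigma> Q Qb i j (V j)))"
proof -
  define f where "f i j = V i \<bullet> low_H \<Sigma> Q Qb i j (V j)" for i j
  have "V i \<bullet> op_H \<Sigma> Q R Qb N V i =
      (\<Sum>j=1..<i. f i j) + V i \<bullet> diag_H \<Sigma> Q R Qb (V i) + (\<Sum>j=Suc i..N. f j i)" if "i \<in> {1..N}" for i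
  proof -
    have "V i \<bullet> block_H \<Sigma> Q R Qb i j (V j) = f j i" if "j \<in> {Suc i..N}" for j
      using that by (simp add: block_H_def f_def inner_adjoint bounded_linear_low_H inner_commute)
    moreover have "V i \<bullet> block_H \<Sigma> Q R Qb i j (V j) = f i j" if "j \<in> {1..<i}" for j
      using that by (simp add: block_H_def f_def)
    ultimately show ?thesis
      unfolding op_H_def sum_split_diagonal[OF that] inner_add_right inner_sum_right by (simp add: block_H_def)
  qed
  then have "(\<Sum>i=1..N. V i \<bullet> op_H \<Sigma> Q R Qb N V i) =
      (\<Sum>i=1..N. (\<Sum>j=1..<i. f i j) + V i \<bullet> diag_H \<Sigma> Q R Qb (V i) + (\<Sum>j=Suc i..N. f j i))"
    by simp
  also have "\<dots> = (\<Sum>i=1..N. V i \<bullet> diag_H \<Sigma> Q R Qb (V i) + 2 * (\<Sum>j=1..<i. f i j))"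
    using sum_triangle_swap[of "\<lambda>i j. f j i" N] by (simp add: sum.distrib sum_distrib_left)
  finally show ?thesis by (simp add: f_def)
qed

text \<open>The two costs differ by a term free of \<open>V\<close>, so the quadratic program
  minimizes the plan cost.\<close>

lemma cost_J_eq_plan_cost:
  fixes \<Sigma> :: "('x::{real_inner,banach}, 'u::euclidean_space, 'y::real_inner) dt_system"
  assumes "lyapunov_eq \<Sigma> Q Qb" "self_adjoint_op Q" "self_adjoint_op Qb"
  shows "cost_J \<Sigma> Q R Qb N V x + x \<bullet> Qb x = plan_cost \<Sigma> Q R Qb N x V"
proof -
  have "plan_cost \<Sigma> Q R Qb N x V = x \<bullet> Qb x +
      (\<Sum>i=1..N. V i \<bullet> diag_H \<Sigma> Q R Qb (V i) +
        2 * (V i \<bullet> op_P \<Sigma> Q Qb x i + (\<Sum>j=1..<i. V i \<bullet> low_H \<Sigma> Q Qb i j (V j))))"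
    unfolding plan_cost_eq_sum[OF assms] by (simp add: op_P_dt_state[unfolded One_nat_def])
  then show ?thesis
    unfolding cost_J_def inner_op_H by (simp add: sum.distrib sum_distrib_left algebra_simps)
qed

section \<open>Positivity, convexity and shift of the plan cost\<close>

lemma plan_cost_nonneg:
  assumes "pos_semidef Q" "pos_semidef R" "pos_semidef Qb"
  shows "0 \<le> plan_cost \<Sigma> Q R Qb N x v"
  unfolding plan_cost_def by (intro add_nonneg_nonneg sum_nonneg pos_semidef_nonneg assms)

text \<open>Convexity handles the output and terminal terms; the input term obeys the exact
  parallelogram identity and leaves the strong convexity term in \<open>R\<close>.\<close>

lemma plan_cost_midpoint_le:
  assumes "pos_semidef Q" "self_adjoint_op R" "pos_semidef Qb"
  shows "plan_cost \<Sigma> Q R Qb N x (\<lambda>i. (1/2) *\<^sub>R (v i + w i)) \<le>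
    (plan_cost \<Sigma> Q R Qb N x v + plan_cost \<Sigma> Q R Qb N x w) / 2 -
    (\<Sum>i=1..N. (v i - w i) \<bullet> R (v i - w i)) / 4"
proof -
  let ?m = "\<lambda>i. (1/2) *\<^sub>R (v i + w i)"
  let ?q = "\<lambda>v j. dt_output \<Sigma> x v j \<bullet> Q (dt_output \<Sigma> x v j)"
  have "(\<Sum>j=1..N. ?q ?m j + ?m j \<bullet> R (?m j)) \<le>
      (\<Sum>j=1..N. (?q v j + ?q w j) / 2 +
        ((v j \<bullet> R (v j) + w j \<bullet> R (w j)) / 2 - ((v j - w j) \<bullet> R (v j - w j)) / 4))"
    unfolding dt_output_midpoint quadratic_form_midpoint[OF assms(2)]
    by (intro sum_mono add_right_mono quadratic_form_midpoint_le assms(1))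
  moreover have "dt_state \<Sigma> x ?m N \<bullet> Qb (dt_state \<Sigma> x ?m N) \<le>
      (dt_state \<Sigma> x v N \<bullet> Qb (dt_state \<Sigma> x v N) + dt_state \<Sigma> x w N \<bullet> Qb (dt_state \<Sigma> x w N)) / 2"
    unfolding dt_state_midpoint by (rule quadratic_form_midpoint_le[OF assms(3)])
  ultimately show ?thesis
    unfolding plan_cost_def
    by (simp add: sum.distrib sum_subtractf add_divide_distrib flip: sum_divide_distrib)
qed

text \<open>The Lyapunov equation makes \<open>Qb\<close> the exact cost of running with zero input, so lengthening
  the horizon of a zero-tailed plan does not change its cost.\<close>

lemma plan_cost_shift_le:
  fixes \<Sigma> :: "('x::{real_inner,banach}, 'u::real_inner, 'y::real_inner) dt_system"
  assumes "lyapunov_eq \<Sigma> Q Qb" "pos_semidef Q" "pos_semidef R"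
  shows "plan_cost \<Sigma> Q R Qb N (dt_state \<Sigma> x (zero_tail N V) (Suc 0)) (\<lambda>i. zero_tail N V (Suc i))
    \<le> plan_cost \<Sigma> Q R Qb N x V"
proof -
  let ?z = "zero_tail N V"
  let ?s = "\<lambda>j. dt_output \<Sigma> x ?z j \<bullet> Q (dt_output \<Sigma> x ?z j) + ?z j \<bullet> R (?z j)"
  let ?t = "\<lambda>j. dt_state \<Sigma> x ?z j \<bullet> Qb (dt_state \<Sigma> x ?z j)"
  have "plan_cost \<Sigma> Q R Qb N (dt_state \<Sigma> x ?z (Suc 0)) (\<lambda>i. ?z (Suc i)) = (\<Sum>j=1..N. ?s (Suc j)) + ?t (Suc N)"
    unfolding plan_cost_def dt_state_shift by (simp add: dt_output_shift del: dt_state.simps)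
  also have "\<dots> \<le> (\<Sum>j=1..Suc N. ?s j) + ?t (Suc N)"
  proof -
    have "0 \<le> ?s 1" by (intro add_nonneg_nonneg pos_semidef_nonneg assms)
    moreover have "(\<Sum>j=1..Suc N. ?s j) = ?s 1 + (\<Sum>j=1..N. ?s (Suc j))"
      by (simp add: sum.atLeast_Suc_atMost sum.atLeast_Suc_atMost_Suc_shift del: sum.cl_ivl_Suc)
    ultimately show ?thesis by linarith
  qed
  \<comment> \<open>Stage \<open>Suc N\<close> has zero input, so its cost and the terminal weight
    at \<open>Suc N\<close> add up to the terminal weight at \<open>N\<close>.\<close>
  also have "\<dots> = (\<Sum>j=1..N. ?s j) + ?t N"
    using lyapunov_eq_quadratic[OF assms(1), of "dt_state \<Sigma> x ?z N"]
    by (simp add: zero_tail_def dt_output_def)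
  also have "\<dots> = plan_cost \<Sigma> Q R Qb N x V"
  proof -
    have z: "?z i = V i" if "i \<in> {1..N}" for i using that by (simp add: zero_tail_def)
    then have "dt_output \<Sigma> x ?z j = dt_output \<Sigma> x V j" if "j \<in> {1..N}" for j
      using that by (intro dt_output_cong) auto
    moreover have "dt_state \<Sigma> x ?z N = dt_state \<Sigma> x V N" using z by (rule dt_state_cong)
    ultimately show ?thesis using z by (simp add: plan_cost_def)
  qed
  finally show ?thesis .
qed

section \<open>Convergence of the control scheme\<close>

lemma midpoint_bounds:
  fixes a b l :: "'a::ordered_real_vector"
  shows "l \<le> a \<Longrightarrow> l \<le> b \<Longrightarrow> l \<le> (1/2) *\<^sub>R (a + b)"
    and "a \<le> l \<Longrightarrow> b \<le> l \<Longrightarrow> (1/2) *\<^sub>R (a + b) \<le> l"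
proof -
  have half: "(1/2) *\<^sub>R (l + l) = l" by (simp flip: scaleR_2)
  show "l \<le> (1/2) *\<^sub>R (a + b)" if "l \<le> a" "l \<le> b"
    using scaleR_left_mono[OF add_mono[OF that], of "1/2"] by (simp add: half del: scaleR_add_right)
  show "(1/2) *\<^sub>R (a + b) \<le> l" if "a \<le> l" "b \<le> l"
    using scaleR_left_mono[OF add_mono[OF that], of "1/2"] by (simp add: half del: scaleR_add_right)
qed

lemma qp_constraints_midpoint:
  assumes "qp_constraints \<Sigma> N umin umax ymin ymax x V" "qp_constraints \<Sigma> N umin umax ymin ymax x W"
  shows "qp_constraints \<Sigma> N umin umax ymin ymax x (\<lambda>i. (1/2) *\<^sub>R (V i + W i))"
  using assms unfolding qp_constraints_iff dt_output_midpoint by (blast intro: midpoint_bounds)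

text \<open>The minimizer \<open>V\<close> is compared with the midpoint of \<open>V\<close> and \<open>W\<close>.\<close>

lemma qp_solution_gap:
  fixes \<Sigma> :: "('x::{real_inner,banach}, real^'m, real^'p) dt_system"
  assumes "lyapunov_eq \<Sigma> Q Qb" "pos_semidef Q" "pos_semidef R" "pos_semidef Qb"
    and "qp_solution \<Sigma> Q R Qb N umin umax ymin ymax x V"
    and "qp_constraints \<Sigma> N umin umax ymin ymax x W"
  shows "(\<Sum>i=1..N. (V i - W i) \<bullet> R (V i - W i)) \<le>
    2 * (plan_cost \<Sigma> Q R Qb N x W - plan_cost \<Sigma> Q R Qb N x V)"
proof -
  let ?M = "\<lambda>i. (1/2) *\<^sub>R (V i + W i)"
  have sa: "self_adjoint_op Q" "self_adjoint_op R" "self_adjoint_op Qb"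
    using assms(2-4) by (simp_all add: pos_semidef_def)
  have "qp_constraints \<Sigma> N umin umax ymin ymax x ?M"
    using assms(5,6) by (intro qp_constraints_midpoint) (simp_all add: qp_solution_def)
  then have "cost_J \<Sigma> Q R Qb N V x \<le> cost_J \<Sigma> Q R Qb N ?M x"
    using assms(5) by (simp add: qp_solution_def)
  then have "plan_cost \<Sigma> Q R Qb N x V \<le> plan_cost \<Sigma> Q R Qb N x ?M"
    by (simp flip: cost_J_eq_plan_cost[OF assms(1) sa(1,3)])
  \<comment> \<open>Minimality and the midpoint estimate put a quarter of the sum below half the
    cost difference, hence the factor 2.\<close>
  then show ?thesis
    using plan_cost_midpoint_le[OF assms(2) sa(2) assms(4), of \<Sigma> N x V W] by argo
qed

text \<open>Recursive feasibility: the bounds at times 2 to \<open>N + 1\<close> of the zero-tailed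
  plan become those at times 1 to \<open>N\<close>. Time \<open>N + 1\<close> is the one taken from
  beyond the horizon.\<close>

lemma infinite_horizon_feasible_shift:
  assumes "infinite_horizon_feasible \<Sigma> N umin umax ymin ymax x V"
  shows "qp_constraints \<Sigma> N umin umax ymin ymax (dt_state \<Sigma> x (zero_tail N V) (Suc 0))
    (\<lambda>i. zero_tail N V (Suc i))"
  using assms unfolding qp_constraints_iff infinite_horizon_feasible_def
  by (simp add: dt_output_shift del: dt_state.simps)

lemma tendsto_shift_chain:
  fixes U :: "nat \<Rightarrow> nat \<Rightarrow> 'a::real_normed_vector"
  assumes "\<And>i. i \<in> {1..N} \<Longrightarrow> (\<lambda>k. U (Suc k) i - zero_tail N (U k) (Suc i)) \<longlonglongrightarrow> 0"
    and "i \<in> {1..N}"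
  shows "(\<lambda>k. U k i) \<longlonglongrightarrow> 0"
proof -
  \<comment> \<open>Here \<open>n\<close> counts from the end: \<open>n = 0\<close> is index
    \<open>N + 1\<close>, where the zero-tailed plan vanishes, and \<open>n = N\<close> is index
    1.\<close>
  have tail: "(\<lambda>k. zero_tail N (U k) (Suc N - n)) \<longlonglongrightarrow> 0" if "n \<le> N" for n
    using that
  proof (induction n)
    case (Suc n)
    define i where "i = N - n"
    have i: "i \<in> {1..N}" "Suc N - n = Suc i" "Suc N - Suc n = i" using Suc.prems by (auto simp: i_def)
    have "(\<lambda>k. (U (Suc k) i - zero_tail N (U k) (Suc i)) + zero_tail N (U k) (Suc i)) \<longlonglongrightarrow> 0 + 0"
      using Suc i by (intro tendsto_add assms) simp_all
    then have "(\<lambda>k. U (Suc k) i) \<longlonglongrightarrow> 0" by simp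
    then have "(\<lambda>k. U k i) \<longlonglongrightarrow> 0" by (rule LIMSEQ_imp_Suc)
    then show ?case using i by (simp add: zero_tail_def)
  qed (simp add: zero_tail_def)
  have "Suc N - i \<le> N" using assms(2) by auto
  from tail[OF this] show ?thesis using assms(2) by (simp add: zero_tail_def)
qed

lemma mpc_run_tendsto_0:
  fixes \<Sigma> :: "('x::{real_inner,banach}, real^'m, real^'p) dt_system"
  assumes lyap: "lyapunov_eq \<Sigma> Q Qb"
    and "pos_def Q" "pos_def R" and Qb: "pos_semidef Qb"
    and "N \<ge> 1"
    and run: "mpc_run \<Sigma> Q R Qb N umin umax ymin ymax x0 x U u"
    and feas: "\<And>k. infinite_horizon_feasible \<Sigma> N umin umax ymin ymax (x k) (U k)"
    and "i \<in> {1..N}"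
  shows "(\<lambda>k. U k i) \<longlonglongrightarrow> 0"
proof (rule tendsto_shift_chain[OF _ \<open>i \<in> {1..N}\<close>])
  fix i assume i: "i \<in> {1..N}"
  have Q: "pos_semidef Q" and R: "pos_semidef R"
    using \<open>pos_def Q\<close> \<open>pos_def R\<close> by (simp_all add: pos_def_imp_pos_semidef)
  obtain r where r: "r > 0" "\<And>v. r * (norm v)\<^sup>2 \<le> v \<bullet> R v" using pos_def_coercive[OF \<open>pos_def R\<close>] by blast
  define W where "W k = (\<lambda>i. zero_tail N (U k) (Suc i))" for k
  define F where "F k = plan_cost \<Sigma> Q R Qb N (x k) (U k)" for k
  \<comment> \<open>The applied input is the first entry of the plan, so the closed loop moves to
    the plan's own first state; \<open>N \<ge> 1\<close> puts index 1 inside the horizon.\<close>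
  have x_Suc: "x (Suc k) = dt_state \<Sigma> (x k) (zero_tail N (U k)) (Suc 0)" for k
    using run \<open>N \<ge> 1\<close> by (simp add: mpc_run_def zero_tail_def)
  have gap: "(\<Sum>i=1..N. (U (Suc k) i - W k i) \<bullet> R (U (Suc k) i - W k i)) \<le> 2 * (F k - F (Suc k))" for k
  proof -
    have "qp_solution \<Sigma> Q R Qb N umin umax ymin ymax (x (Suc k)) (U (Suc k))"
      using run unfolding mpc_run_def by blast
    moreover have "qp_constraints \<Sigma> N umin umax ymin ymax (x (Suc k)) (W k)"
      unfolding x_Suc W_def by (rule infinite_horizon_feasible_shift[OF feas])
    ultimately have "(\<Sum>i=1..N. (U (Suc k) i - W k i) \<bullet> R (U (Suc k) i - W k i)) \<le>
        2 * (plan_cost \<Sigma> Q R Qb N (x (Suc k)) (W k) - F (Suc k))"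
      unfolding F_def by (rule qp_solution_gap[OF lyap Q R Qb])
    moreover have "plan_cost \<Sigma> Q R Qb N (x (Suc k)) (W k) \<le> F k"
      unfolding x_Suc W_def F_def by (rule plan_cost_shift_le[OF lyap Q R])
    ultimately show ?thesis by argo
  qed
  have "F (Suc k) \<le> F k" for k
    using gap[of k] sum_nonneg[of "{1..N}" "\<lambda>i. (U (Suc k) i - W k i) \<bullet> R (U (Suc k) i - W k i)"]
      pos_semidef_nonneg[OF R] by fastforce
  then have "decseq F" by (simp add: decseq_Suc_iff)
  moreover have "0 \<le> F k" for k unfolding F_def by (rule plan_cost_nonneg[OF Q R Qb])
  ultimately obtain L where "F \<longlonglongrightarrow> L" using decseq_convergent[of F 0] by blast
  then have "(\<lambda>k. 2 / r * (F k - F (Suc k))) \<longlonglongrightarrow> 2 / r * (L - L)"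
    by (intro tendsto_intros LIMSEQ_Suc)
  then have lim: "(\<lambda>k. 2 / r * (F k - F (Suc k))) \<longlonglongrightarrow> 0" by simp
  \<comment> \<open>The constant \<open>2 / r\<close> combines coercivity of \<open>R\<close> with
    the factor 2 of \<open>gap\<close>, applied to one term of the nonnegative sum.\<close>
  have "(norm (U (Suc k) i - W k i))\<^sup>2 \<le> 2 / r * (F k - F (Suc k))" for k
  proof -
    have "r * (norm (U (Suc k) i - W k i))\<^sup>2 \<le> (U (Suc k) i - W k i) \<bullet> R (U (Suc k) i - W k i)"
      by (rule r)
    also have "\<dots> \<le> (\<Sum>i=1..N. (U (Suc k) i - W k i) \<bullet> R (U (Suc k) i - W k i))"
      by (rule member_le_sum[OF i]) (simp_all add: pos_semidef_nonneg[OF R])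
    finally show ?thesis using gap[of k] r(1) by (simp add: field_simps)
  qed
  then have "(\<lambda>k. (norm (U (Suc k) i - W k i))\<^sup>2) \<longlonglongrightarrow> 0"
    by (intro Lim_null_comparison[OF _ lim] always_eventually allI) (simp only: real_norm_def abs_power2)
  from tendsto_real_sqrt[OF this]
  show "(\<lambda>k. U (Suc k) i - zero_tail N (U k) (Suc i)) \<longlonglongrightarrow> 0"
    by (simp add: W_def tendsto_norm_zero_iff)
qed

theorem theorem3p1:
  fixes T :: "real \<Rightarrow> 'x::{real_inner,banach,second_countable_topology} \<Rightarrow>\<^sub>L 'x"
    and DA :: "'x set" and A :: "'x \<Rightarrow> 'x"
    and J :: "'x \<Rightarrow>\<^sub>L 'z::{banach,second_countable_topology}"
    and B :: "(real^'m) \<Rightarrow>\<^sub>L 'z" and C :: "'x \<Rightarrow> real^'p" and D :: "(real^'m) \<Rightarrow>\<^sub>L (real^'p)"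
    and G :: "real \<Rightarrow> (real^'m) \<Rightarrow>\<^sub>L (real^'p)"
    and \<Sigma> :: "('x, real^'m, real^'p) dt_system"
    and Q :: "(real^'p) \<Rightarrow>\<^sub>L (real^'p)" and R :: "(real^'m) \<Rightarrow>\<^sub>L (real^'m)" and Qb :: "'x \<Rightarrow>\<^sub>L 'x"
    and s0 h \<delta> :: real and N :: nat
    and umin umax :: "real^'m" and ymin ymax :: "real^'p"
    and x0 :: 'x and x :: "nat \<Rightarrow> 'x"
    and U :: "nat \<Rightarrow> nat \<Rightarrow> real^'m" and u :: "nat \<Rightarrow> real^'m"
  assumes "regular_linear_system s0 T DA A J B C D G"
    and "h > 0" and "\<delta> = 2 / h" and "\<delta> \<in> resolvent_set DA A"
    and "\<Sigma> = cayley_tustin DA A J B C G \<delta>"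
    and "pos_def Q" and "pos_def R"
    and "N \<ge> 1"
    and "strongly_stable T"
    and "infinite_time_admissible T DA C"
    and "pos_semidef Qb" and "lyapunov_eq \<Sigma> Q Qb"
    and "mpc_run \<Sigma> Q R Qb N umin umax ymin ymax x0 x U u"
    and "\<And>k. infinite_horizon_feasible \<Sigma> N umin umax ymin ymax (x k) (U k)"
  shows "(\<lambda>k. L2_set (\<lambda>i. norm (U k i)) {1..N}) \<longlonglongrightarrow> 0 \<and> u \<longlonglongrightarrow> 0"
proof
  note run = assms(13)
  have U: "(\<lambda>k. U k i) \<longlonglongrightarrow> 0" if "i \<in> {1..N}" for i
    by (rule mpc_run_tendsto_0[OF assms(12) assms(6,7,11,8) run assms(14) that])
  \<comment> \<open>This is the norm of the plan in the product space, continuous in its finitely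
    many entries.\<close>
  have "(\<lambda>k. L2_set (\<lambda>i. norm (U k i)) {1..N}) \<longlonglongrightarrow> L2_set (\<lambda>i. norm (0 :: real^'m)) {1..N}"
    unfolding L2_set_def by (intro tendsto_intros U)
  then show "(\<lambda>k. L2_set (\<lambda>i. norm (U k i)) {1..N}) \<longlonglongrightarrow> 0" by (simp add: L2_set_def)
  \<comment> \<open>The scheme prescribes \<open>u\<close> from index 1 on, so the limit is first
    obtained for the shifted sequence.\<close>
  have "(\<lambda>k. u (Suc k)) \<longlonglongrightarrow> 0" using U[of 1] run assms(8) by (simp add: mpc_run_def)
  then show "u \<longlonglongrightarrow> 0" by (rule LIMSEQ_imp_Suc)
qed

end
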